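(* Let $\Phi:\mathbb{R}^3\to\mathbb{R}$ be a potential generating an integrable system. Let $f_1,f_2,f_3$ be three independent steady-state distribution functions (real-valued) of matter in this system, defined in some common domains of $\mathbb{R}^3_x\times\mathbb{R}^3_v$ such that a collection of parts of the surfaces $f_i(x,v)=\mathrm{const}$ ($i=1,2,3$) forms, through the intersections of these surfaces, a succession of torus patches connected in $x$. Then the functions $f_1,f_2,f_3$ uniquely determine the potential $\Phi$ up to an additive constant on the region of $\mathbb{R}^3_x$ accessible to the system. That is, if $\Phi'$ is any potential generating an integrable system in which the same functions $f_1,f_2,f_3$ are independent steady-state distribution functions, with the same intersections forming such a succession of torus patches for $\Phi'$, then $\Phi'-\Phi$ is constant on that region.
   Context: Motion in a potential $\Phi$ is given by $\frac{d^2x}{dt^2}=-\nabla\Phi(x)$, $v=dx/dt$. The energy $E(x,v)=\frac12\langle v,v\rangle+\Phi(x)$ is constant along orbits. Integrable system: $\Phi$ generates an integrable system if all orbits are confined to 3-tori (diffeomorphic to $S^1\times S^1\times S^1$) in $\mathbb{R}^3_x\times\mathbb{R}^3_v$. Each torus is defined by $I_i(x,v)=\mathrm{const}$, $i=1,2,3$, where the isolating integrals $I=(I_1,I_2,I_3)$ are functions constant along every orbit. They label the tori one-to-one. Any one torus is the closure of a generic (non-resonant) orbit, and the energy $E$ is constant on each torus. Steady-state distribution function: a function $f(x,v)$ satisfying $\langle v,\nabla_x f\rangle-\langle\nabla\Phi,\nabla_v f\rangle=0$. In an integrable system it is of the form $f(x,v)=f[I_1(x,v),I_2(x,v),I_3(x,v)]$.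 It need not represent all the matter in the system. Independence of $f_1,f_2,f_3$: viewed as functions of $I\in\mathbb{R}^3$, the set of equations $f_i(I)=C_i$, $i=1,2,3$, has a nonzero finite number of solutions $I$ for the values $(C_1,C_2,C_3)$ that are used. Thus the intersection of the three surfaces $f_i(x,v)=C_i$ is a 3-dimensional set made of (parts of) finitely many tori $I=\mathrm{const}$, and when there is more than one such torus the different tori can be distinguished. Torus patch: an arbitrarily small piece $\Gamma$ of a torus. A set of torus patches is a succession connected in $x$ if the positions $x$ of the patches cover all of the region of $\mathbb{R}^3_x$ accessible to the system, and the patches can be arranged in a sequence in which each patch after the first contains a phase-space point whose position $x$ is also the position of a point of an earlier patch in the sequence. *)

theory Defs
  imports "HOL-Analysis.Analysis"
begin

text \<open>A phase-space point is a pair of a position and a velocity.\<close>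

type_synonym phase = "(real^3) \<times> (real^3)"

definition gradient :: "('a::real_inner \<Rightarrow> real) \<Rightarrow> 'a \<Rightarrow> 'a" where
  "gradient g x = (THE d. GDERIV g x :> d)"

definition orbit :: "(real^3 \<Rightarrow> real) \<Rightarrow> (real \<Rightarrow> phase) \<Rightarrow> bool" where
  "orbit \<Phi> \<gamma> \<longleftrightarrow>
     (\<forall>t. (\<gamma> has_vector_derivative (snd (\<gamma> t), - gradient \<Phi> (fst (\<gamma> t)))) (at t))"

text \<open>
  A subset of phase space that is \<open>C\<^sup>1\<close>-diffeomorphic to the product of three unit circles.
  The bijection \<open>\<psi>\<close> is read in angle coordinates, where it has to be a \<open>C\<^sup>1\<close> immersion; as the
  product of circles is compact, \<open>\<psi>\<close> is then an embedding with image \<open>T\<close>.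
\<close>

definition three_torus :: "phase set \<Rightarrow> bool" where
  "three_torus T \<longleftrightarrow>
     (\<exists>(\<psi> :: complex \<times> complex \<times> complex \<Rightarrow> phase) (\<phi>' :: real^3 \<Rightarrow> (real^3) \<Rightarrow>\<^sub>L phase).
        bij_betw \<psi> (sphere 0 1 \<times> sphere 0 1 \<times> sphere 0 1) T \<and>
        continuous_on UNIV \<phi>' \<and>
        (\<forall>\<theta>. ((\<lambda>\<theta>. \<psi> (cis (\<theta> $ 1), cis (\<theta> $ 2), cis (\<theta> $ 3))) has_derivative
                blinfun_apply (\<phi>' \<theta>)) (at \<theta>) \<and>
             inj (blinfun_apply (\<phi>' \<theta>))))"

definition torus :: "phase set \<Rightarrow> (phase \<Rightarrow> real^3) \<Rightarrow> real^3 \<Rightarrow> phase set" where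
  "torus W I c = {z \<in> W. I z = c}"

definition accessible_region :: "phase set \<Rightarrow> (real^3) set" where
  "accessible_region W = fst ` W"

text \<open>
  \<open>W\<close> is the set of phase-space points of the system. It is a parameter because it cannot be all
  of phase space in the usual examples: an equilibrium at a minimum of the potential, say, lies on
  no invariant 3-torus, and such degenerate orbits have to be left out. The tori are the level sets
  of \<open>I\<close> in \<open>W\<close>, so \<open>I\<close> labels them one-to-one.

  The last clause says that the closure of a generic orbit is a torus: every torus is either such a
  closure or approximated by tori that are. Asking that each torus be the closure of one orbit would
  exclude the resonant tori, which are dense when the frequencies vary with \<open>I\<close>. That the energy is
  constant on every torus is not assumed; it follows by continuity.
\<close>

definition integrable_system ::
    "(real^3 \<Rightarrow> real) \<Rightarrow> phase set \<Rightarrow> (phase \<Rightarrow> real^3) \<Rightarrow> bool" where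
  "integrable_system \<Phi> W I \<longleftrightarrow>
     (\<forall>x \<in> accessible_region W. \<Phi> differentiable (at x)) \<and>
     (\<forall>z \<in> W. \<exists>\<gamma>. orbit \<Phi> \<gamma> \<and> \<gamma> 0 = z) \<and>
     (\<forall>\<gamma>. orbit \<Phi> \<gamma> \<and> \<gamma> 0 \<in> W \<longrightarrow> range \<gamma> \<subseteq> torus W I (I (\<gamma> 0))) \<and>
     (\<forall>c \<in> I ` W. three_torus (torus W I c)) \<and>
     (\<forall>c \<in> I ` W. \<forall>\<epsilon>>0. \<exists>c' \<in> I ` W.
        (\<exists>\<gamma>. orbit \<Phi> \<gamma> \<and> closure (range \<gamma>) = torus W I c') \<and>
        (\<forall>z \<in> torus W I c. \<exists>z' \<in> torus W I c'. dist z z' < \<epsilon>))"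

definition steady_state_df ::
    "(real^3 \<Rightarrow> real) \<Rightarrow> phase set \<Rightarrow> (phase \<Rightarrow> real) \<Rightarrow> bool" where
  "steady_state_df \<Phi> D f \<longleftrightarrow>
     (\<forall>(x, v) \<in> D. f differentiable (at (x, v)) \<and>
        v \<bullet> gradient (\<lambda>y. f (y, v)) x - gradient \<Phi> x \<bullet> gradient (\<lambda>w. f (x, w)) v = 0)"

text \<open>
  \<open>F\<close> is \<open>f\<close> viewed as a function of \<open>I\<close>. It is meaningful only at the values that \<open>I\<close> takes on the
  common domain \<open>D\<close>, so solutions are sought there; \<open>Cs\<close> is the set of the values \<open>(C\<^sub>1, C\<^sub>2, C\<^sub>3)\<close>
  that are used.
\<close>

definition independent_dfs ::
    "(phase \<Rightarrow> real^3) \<Rightarrow> phase set \<Rightarrow> (3 \<Rightarrow> phase \<Rightarrow> real) \<Rightarrow> (real^3) set \<Rightarrow> bool" where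
  "independent_dfs I D f Cs \<longleftrightarrow>
     (\<exists>F :: 3 \<Rightarrow> real^3 \<Rightarrow> real.
        (\<forall>i. \<forall>z \<in> D. f i z = F i (I z)) \<and>
        (\<forall>C \<in> Cs. {J \<in> I ` D. \<forall>i. F i J = C $ i} \<noteq> {} \<and>
                  finite {J \<in> I ` D. \<forall>i. F i J = C $ i}))"

text \<open>
  A patch may or may not contain its relative boundary points; the last condition excludes
  degenerate pieces such as curves.
\<close>

definition torus_patch :: "phase set \<Rightarrow> (phase \<Rightarrow> real^3) \<Rightarrow> phase set \<Rightarrow> bool" where
  "torus_patch W I \<Gamma> \<longleftrightarrow>
     \<Gamma> \<noteq> {} \<and> connected \<Gamma> \<and>
     (\<exists>c \<in> I ` W. \<Gamma> \<subseteq> torus W I c \<and>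
        \<Gamma> \<subseteq> closure (top_of_set (torus W I c) interior_of \<Gamma>))"

text \<open>
  The indexing by all natural numbers includes finite successions: repeat the last patch.
\<close>

definition connected_succession ::
    "phase set \<Rightarrow> (phase \<Rightarrow> real^3) \<Rightarrow> (nat \<Rightarrow> phase set) \<Rightarrow> bool" where
  "connected_succession W I \<Gamma> \<longleftrightarrow>
     (\<forall>k. torus_patch W I (\<Gamma> k)) \<and>
     accessible_region W \<subseteq> (\<Union>k. fst ` \<Gamma> k) \<and>
     (\<forall>k>0. \<exists>j<k. fst ` \<Gamma> k \<inter> fst ` \<Gamma> j \<noteq> {})"

end

theory Submission
  imports Defs
begin

text \<open>
  The energies of \<open>\<Phi>\<close> and \<open>\<Phi>'\<close> have the same kinetic part, so \<open>\<Phi>' - \<Phi>\<close> is a difference of energies.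
  Each energy is constant on every torus of its own system, hence both are constant on a patch that
  lies on a torus of either system. So \<open>\<Phi>' - \<Phi>\<close> is constant over the positions of each patch, and
  shared positions carry the constant along the succession.

  The energy is constant on the closure of an orbit; two points of an arbitrary torus are limits of
  pairs of points that lie on a common orbit closure.
\<close>

definition energy :: "(real^3 \<Rightarrow> real) \<Rightarrow> phase \<Rightarrow> real" where
  "energy \<Phi> z = (snd z \<bullet> snd z) / 2 + \<Phi> (fst z)"

lemma gderiv_unique:
  assumes "GDERIV g x :> d" "GDERIV g x :> e"
  shows "d = e"
proof -
  have "(\<lambda>h. h \<bullet> d) = (\<lambda>h. h \<bullet> e)"
    using assms has_derivative_unique unfolding gderiv_def by blast
  then show ?thesis
    by (metis vector_eq_ldot)
qed

text \<open>This shows that the \<open>THE\<close> in \<open>gradient\<close> picks out a genuine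
  gradient: the Riesz representation of the derivative provides existence, and
  \<open>gderiv_unique\<close> uniqueness.\<close>

lemma gderiv_gradient:
  fixes g :: "'a::euclidean_space \<Rightarrow> real"
  assumes "g differentiable (at x)"
  shows "GDERIV g x :> gradient g x"
proof -
  obtain g' where g': "(g has_derivative g') (at x)"
    using assms by (auto simp: differentiable_def)
  then have "linear g'"
    by (rule has_derivative_linear)
  \<comment> \<open>The Riesz vector of a linear functional is its adjoint applied to 1, since the
    inner product on the reals is multiplication.\<close>
  then have "g' h = h \<bullet> adjoint g' 1" for h
    using adjoint_works[of g' h 1] by simp
  then have "g' = (\<lambda>h. h \<bullet> adjoint g' 1)"
    by blast
  then have "GDERIV g x :> adjoint g' 1"
    using g' by (simp add: gderiv_def)
  then show ?thesis
    unfolding gradient_def by (rule theI) (use gderiv_unique \<open>GDERIV g x :> adjoint g' 1\<close> in blast)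
qed

lemma isCont_energy:
  assumes "\<Phi> differentiable (at (fst z))"
  shows "isCont (energy \<Phi>) z"
proof -
  have "isCont (\<lambda>z. \<Phi> (fst z)) z"
    using differentiable_imp_continuous_within[OF assms]
    by (intro isCont_o2[where g = \<Phi> and f = fst]) (auto intro: continuous_intros)
  then show ?thesis
    unfolding energy_def by (intro continuous_intros) auto
qed

lemma energy_orbit:
  assumes orbit: "orbit \<Phi> \<gamma>"
    and diff: "\<And>t. \<Phi> differentiable (at (fst (\<gamma> t)))"
  shows "energy \<Phi> (\<gamma> s) = energy \<Phi> (\<gamma> t)"
proof -
  have "((\<lambda>t. energy \<Phi> (\<gamma> t)) has_derivative (\<lambda>h. 0)) (at t)" for t
  proof -
    let ?a = "- gradient \<Phi> (fst (\<gamma> t))"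
    have \<gamma>: "(\<gamma> has_derivative (\<lambda>h. h *\<^sub>R (snd (\<gamma> t), ?a))) (at t)"
      using orbit by (auto simp: orbit_def has_vector_derivative_def)
    have x: "((\<lambda>t. fst (\<gamma> t)) has_derivative (\<lambda>h. h *\<^sub>R snd (\<gamma> t))) (at t)"
      using has_derivative_fst[OF \<gamma>] by simp
    have v: "((\<lambda>t. snd (\<gamma> t)) has_derivative (\<lambda>h. h *\<^sub>R ?a)) (at t)"
      using has_derivative_snd[OF \<gamma>] by simp
    have "(\<Phi> has_derivative (\<lambda>h. h \<bullet> gradient \<Phi> (fst (\<gamma> t)))) (at (fst (\<gamma> t)))"
      using gderiv_gradient[OF diff] by (simp add: gderiv_def)
    from has_derivative_compose[OF x this]
    have \<Phi>: "((\<lambda>t. \<Phi> (fst (\<gamma> t))) has_derivative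
        (\<lambda>h. (h *\<^sub>R snd (\<gamma> t)) \<bullet> gradient \<Phi> (fst (\<gamma> t)))) (at t)" .
    \<comment> \<open>The kinetic term contributes the velocity times \<open>?a\<close> and the
      potential term the velocity times the gradient; these cancel because \<open>?a\<close> is
      minus the gradient.\<close>
    show ?thesis
      unfolding energy_def
      by (rule v \<Phi> derivative_eq_intros refl | simp add: inner_commute)+
  qed
  then obtain k where "\<And>t. energy \<Phi> (\<gamma> t) = k"
    using has_derivative_zero_constant[of UNIV "\<lambda>t. energy \<Phi> (\<gamma> t)"] by auto
  then show ?thesis
    by simp
qed

text \<open>Conservation along the orbit extends to limit points by continuity. Containment of the
  closure in \<open>W\<close> matters because the system guarantees differentiability of \<Phi>, and
  hence continuity of the energy, only over positions of \<open>W\<close>.\<close>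

lemma energy_orbit_closure:
  assumes sys: "integrable_system \<Phi> W I"
    and orbit: "orbit \<Phi> \<gamma>"
    and closure: "closure (range \<gamma>) \<subseteq> W"
    and z: "z \<in> closure (range \<gamma>)"
  shows "energy \<Phi> z = energy \<Phi> (\<gamma> 0)"
proof -
  have diff: "\<Phi> differentiable (at (fst y))" if "y \<in> closure (range \<gamma>)" for y
    using that closure sys by (auto simp: integrable_system_def accessible_region_def)
  have "continuous_on (closure (range \<gamma>)) (energy \<Phi>)"
    using isCont_energy diff by (simp add: continuous_at_imp_continuous_on)
  moreover have "energy \<Phi> y = energy \<Phi> (\<gamma> 0)" if "y \<in> range \<gamma>" for y
    using that energy_orbit[OF orbit] diff closure_subset by (metis rangeE rangeI subsetD)
  ultimately show ?thesis
    using continuous_constant_on_closure[OF _ _ z] by blast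
qed

lemma energy_torus:
  assumes sys: "integrable_system \<Phi> W I"
    and c: "c \<in> I ` W"
    and y: "y \<in> torus W I c" and z: "z \<in> torus W I c"
  shows "energy \<Phi> y = energy \<Phi> z"
proof -
  have "\<exists>y' z'. dist y y' < \<epsilon> \<and> dist z z' < \<epsilon> \<and> energy \<Phi> y' = energy \<Phi> z'" if "\<epsilon> > 0" for \<epsilon>
  proof -
    obtain c' \<gamma> where \<gamma>: "orbit \<Phi> \<gamma>" "closure (range \<gamma>) = torus W I c'"
      and near: "\<forall>z \<in> torus W I c. \<exists>z' \<in> torus W I c'. dist z z' < \<epsilon>"
      using sys c \<open>\<epsilon> > 0\<close> unfolding integrable_system_def by meson
    have "closure (range \<gamma>) \<subseteq> W"
      by (auto simp: \<gamma> torus_def)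
    \<comment> \<open>The points near \<open>y\<close> and \<open>z\<close> are chosen on the same
      torus \<open>c'\<close>, so both have the energy of \<open>\<gamma> 0\<close>.\<close>
    then show ?thesis
      using near y z energy_orbit_closure[OF sys \<gamma>(1)] \<gamma>(2) by metis
  qed
  then have "\<exists>y' z'. dist y y' < inverse (real (Suc n)) \<and> dist z z' < inverse (real (Suc n)) \<and>
      energy \<Phi> y' = energy \<Phi> z'" for n
    by simp
  then obtain Y Z where YZ: "\<And>n. dist y (Y n) < inverse (real (Suc n))"
      "\<And>n. dist z (Z n) < inverse (real (Suc n))" "\<And>n. energy \<Phi> (Y n) = energy \<Phi> (Z n)"
    by metis
  have lim: "X \<longlonglongrightarrow> x" if "\<And>n. dist x (X n) < inverse (real (Suc n))" for X and x :: phase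
  proof -
    have "(\<lambda>n. dist (X n) x) \<longlonglongrightarrow> 0"
      by (rule tendsto_sandwich[OF _ _ tendsto_const LIMSEQ_inverse_real_of_nat])
        (use that in \<open>auto simp: dist_commute intro!: always_eventually less_imp_le\<close>)
    then show ?thesis
      by (rule tendsto_dist_iff[THEN iffD2])
  qed
  \<comment> \<open>Sequential continuity at the two limits \<open>y\<close> and \<open>z\<close>
    carries the equality of energies from the sequences to the limits.\<close>
  have cont: "isCont (energy \<Phi>) x" if "x \<in> torus W I c" for x
    using that sys isCont_energy
    by (auto simp: integrable_system_def accessible_region_def torus_def)
  have "(\<lambda>n. energy \<Phi> (Y n)) \<longlonglongrightarrow> energy \<Phi> y" "(\<lambda>n. energy \<Phi> (Z n)) \<longlonglongrightarrow> energy \<Phi> z"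
    using isCont_tendsto_compose cont y z lim YZ by blast+
  then show ?thesis
    using YZ(3) LIMSEQ_unique by simp
qed

lemma energy_torus_patch:
  assumes "integrable_system \<Phi> W I" "torus_patch W I \<Gamma>" "y \<in> \<Gamma>" "z \<in> \<Gamma>"
  shows "energy \<Phi> y = energy \<Phi> z"
  using assms energy_torus unfolding torus_patch_def by blast

text \<open>Strong induction is the right form: a set may meet any earlier one, not just its
  predecessor, and a shared point passes on the value taken on \<open>A 0\<close>.\<close>

lemma constant_along_succession:
  assumes "\<And>k x y. x \<in> A k \<Longrightarrow> y \<in> A k \<Longrightarrow> g x = g y"
    and "\<And>k::nat. k > 0 \<Longrightarrow> \<exists>j<k. A k \<inter> A j \<noteq> {}"
  shows "\<exists>c. \<forall>x \<in> (\<Union>k. A k). g x = c"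
proof (cases "A 0 = {}")
  case False
  then obtain a where a: "a \<in> A 0"
    by blast
  have "\<forall>x \<in> A k. g x = g a" for k
  proof (induction k rule: less_induct)
    case (less k)
    show ?case
    proof (cases "k = 0")
      case True
      then show ?thesis
        using assms(1) a by blast
    next
      case False
      then obtain j b where "j < k" "b \<in> A k" "b \<in> A j"
        using assms(2) by blast
      then show ?thesis
        using less assms(1) by metis
    qed
  qed
  then show ?thesis
    by blast
next
  \<comment> \<open>Every later set meets an earlier one, so an empty first set would leave no
    nonempty set to begin with; the union is empty and the claim vacuous.\<close>
  case True
  have "A k = {}" for k
  proof (induction k rule: less_induct)
    case (less k)
    then show ?case
      using True assms(2) by (cases "k = 0") blast+
  qed
  then show ?thesis
    by simp
qed

theorem theorem3p2:
  fixes \<Phi> \<Phi>' :: "real^3 \<Rightarrow> real"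
    and W W' D :: "phase set"
    and I I' :: "phase \<Rightarrow> real^3"
    and f :: "3 \<Rightarrow> phase \<Rightarrow> real"
    and C :: "nat \<Rightarrow> real^3"
    and S :: "nat \<Rightarrow> 3 \<Rightarrow> phase set"
  assumes domain: "open D"
    and surface_parts: "\<And>k i. S k i \<subseteq> {z \<in> D. f i z = C k $ i}"
    and system: "integrable_system \<Phi> W I" "D \<subseteq> W"
    and dfs: "\<And>i. steady_state_df \<Phi> D (f i)" "independent_dfs I D f (range C)"
    and patches: "connected_succession W I (\<lambda>k. \<Inter>i. S k i)"
    and system': "integrable_system \<Phi>' W' I'" "D \<subseteq> W'"
    and dfs': "\<And>i. steady_state_df \<Phi>' D (f i)" "independent_dfs I' D f (range C)"
    and patches': "connected_succession W' I' (\<lambda>k. \<Inter>i. S k i)"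
  shows "\<exists>c. \<forall>x \<in> accessible_region W. \<Phi>' x - \<Phi> x = c"
proof -
  define \<Gamma> where "\<Gamma> k = (\<Inter>i. S k i)" for k
  \<comment> \<open>The patches are cut out by \<open>f\<close> alone, so the same sets lie on tori
    of both systems, although \<open>I\<close> and \<open>I'\<close> may differ.\<close>
  have "torus_patch W I (\<Gamma> k)" "torus_patch W' I' (\<Gamma> k)" for k
    using patches patches' by (auto simp: connected_succession_def \<Gamma>_def)
  then have energy: "energy \<Phi> y = energy \<Phi> z" "energy \<Phi>' y = energy \<Phi>' z"
    if "y \<in> \<Gamma> k" "z \<in> \<Gamma> k" for k y z
    using that energy_torus_patch system(1) system'(1) by blast+
  \<comment> \<open>The left side depends on the position only, so different velocities over a
    shared position do no harm.\<close>
  have difference: "\<Phi>' (fst z) - \<Phi> (fst z) = energy \<Phi>' z - energy \<Phi> z" for z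
    by (simp add: energy_def)
  have "\<exists>c. \<forall>x \<in> (\<Union>k. fst ` \<Gamma> k). \<Phi>' x - \<Phi> x = c"
  proof (rule constant_along_succession)
    show "\<Phi>' x - \<Phi> x = \<Phi>' y - \<Phi> y" if xy: "x \<in> fst ` \<Gamma> k" "y \<in> fst ` \<Gamma> k" for k x y
    proof -
      obtain y' z' where "y' \<in> \<Gamma> k" "z' \<in> \<Gamma> k" "x = fst y'" "y = fst z'"
        using xy by blast
      then show ?thesis
        by (simp only: difference energy[of y' k z'])
    qed
    show "\<exists>j<k. fst ` \<Gamma> k \<inter> fst ` \<Gamma> j \<noteq> {}" if "k > 0" for k
      using patches that by (simp add: connected_succession_def \<Gamma>_def)
  qed
  moreover have "accessible_region W \<subseteq> (\<Union>k. fst ` \<Gamma> k)"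
    using patches by (simp add: connected_succession_def \<Gamma>_def)
  ultimately show ?thesis
    by (meson subsetD)
qed

end
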